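(* Let $\mathcal{G}=(V,E)$ be a graph, $s\in\mathbb{N}$ with $s\le|\bar E|$, $\alpha\in(0,2)$, $\beta>0$, and let $p\in\mathcal{P}_s$. The following are equivalent: (i) $p$ is a local maximizer of $h_{\mathcal{G}}$ on $\mathcal{P}_s$; (ii) $p\in\mathcal{M}_s(\mathcal{G})$, i.e. $p$ is a strict local maximizer of $h_{\mathcal{G}}$ on $\mathcal{P}_s$; (iii) $p=(x^{(C)},y^{(p)})$ where $s=e^{\intercal}y^{(p)}\in\mathbb{N}$, $C$ is an $s$-defective clique in $\mathcal{G}$ which is also a maximal clique in $\mathcal{G}(y^{(p)})$, and $y^{(p)}\in D_s(\mathcal{G})$ is such that $y^{(p)}_{ij}=1$ for every $\{i,j\}\in\binom{C}{2}\cap\bar E$. In either of these equivalent cases, $$h_{\mathcal{G}}(p)=1-\frac{2-\alpha}{2|C|}+s\,\frac{\beta}{2}.$$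
   Context: $\mathcal{G}=(V,E)$ is a finite simple undirected graph, $n=|V|$, $V$ identified with $\{1,\dots,n\}$, $A_{\mathcal{G}}$ is its adjacency matrix, and $\bar{\mathcal{G}}=(V,\bar E)$ is the complementary graph. $e$ is the all-ones vector. For $s\in\mathbb{N}$ with $s\le|\bar E|$ let $D_s(\mathcal{G})=\{y\in\{0,1\}^{\bar E} : e^{\intercal}y\le s\}$ and $D'_s(\mathcal{G})=\{y\in[0,1]^{\bar E} : e^{\intercal}y\le s\}$. For $y\in D'_s(\mathcal{G})$, $A(y)\in\mathbb{R}^{n\times n}$ is the symmetric matrix with $A(y)_{ij}=y_{ij}$ if $\{i,j\}\in\bar E$ and $A(y)_{ij}=0$ if $\{i,j\}\notin\bar E$. For $y\in D_s(\mathcal{G})$, $\mathcal{G}(y)$ is the graph with adjacency matrix $A_{\mathcal{G}}+A(y)$ (the edge $\{i,j\}$ is added to $\mathcal{G}$ whenever $y_{ij}=1$). $\Delta_{n-1}$ is the $(n-1)$-dimensional standard simplex in $\mathbb{R}^n$ and $\mathcal{P}_s=\Delta_{n-1}\times D'_s(\mathcal{G})$. For $\alpha\in(0,2)$, $\beta>0$, and $z=(x,y)\in\mathcal{P}_s$, $$h_{\mathcal{G}}(x,y)=x^{\intercal}[A_{\mathcal{G}}+A(y)]x+\frac{\alpha}{2}\|x\|^2+\frac{\beta}{2}\|y\|^2$$ (Euclidean norms). $\mathcal{M}_s(\mathcal{G})$ is the set of strict local maximizers of $h_{\mathcal{G}}$ on $\mathcal{P}_s$. For nonempty $C\subseteq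 V$, $x^{(C)}=\frac1{|C|}\sum_{i\in C}e_i$, with $e_i$ the standard basis vectors. An $s$-defective clique in $\mathcal{G}$ is a subset $C\subseteq V$ such that at most $s$ pairs in $\binom{C}{2}$ are not edges of $\mathcal{G}$. A maximal clique is a clique not properly contained in another clique. *)

theory Defs
  imports "HOL-Analysis.Analysis" "HOL-Library.Ramsey"
begin

text \<open>
  The vertex set is the finite type \<^typ>\<open>'n\<close>; a graph is given by its set of edges, which are
  two-element sets of vertices. \<^term>\<open>[UNIV]\<^bsup>2\<^esup>\<close> and \<^const>\<open>clique\<close> are those of \<^theory>\<open>HOL-Library.Ramsey\<close>.
\<close>

definition simple_graph :: "'n::finite set set \<Rightarrow> bool" where
  "simple_graph E \<longleftrightarrow> E \<subseteq> [UNIV]\<^bsup>2\<^esup>"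

definition compl_edges :: "'n::finite set set \<Rightarrow> 'n set set" where
  "compl_edges E = [UNIV]\<^bsup>2\<^esup> - E"

definition adj_matrix :: "'n::finite set set \<Rightarrow> real ^ 'n ^ 'n" where
  "adj_matrix E = (\<chi> i j. if {i, j} \<in> E then 1 else 0)"

definition maximal_clique :: "'n::finite set \<Rightarrow> 'n set set \<Rightarrow> bool" where
  "maximal_clique C E \<longleftrightarrow> clique C E \<and> (\<forall>K. clique K E \<longrightarrow> \<not> C \<subset> K)"

definition defective_clique :: "nat \<Rightarrow> 'n::finite set \<Rightarrow> 'n set set \<Rightarrow> bool" where
  "defective_clique s C E \<longleftrightarrow> card ([C]\<^bsup>2\<^esup> - E) \<le> s"

text \<open>
  A vector indexed by the non-edges of the graph is represented by a vector indexed by all sets of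
  vertices whose components outside the non-edges vanish. This embedding is linear and isometric
  (see \<open>norm_D'\<close> below), so the Euclidean norm and the topology are the intended ones.
\<close>

definition D :: "nat \<Rightarrow> 'n::finite set set \<Rightarrow> (real ^ 'n set) set" where
  "D s E = {y. (\<forall>a \<in> compl_edges E. y $ a \<in> {0, 1}) \<and> (\<forall>a. a \<notin> compl_edges E \<longrightarrow> y $ a = 0) \<and>
     (\<Sum>a\<in>compl_edges E. y $ a) \<le> real s}"

definition D' :: "nat \<Rightarrow> 'n::finite set set \<Rightarrow> (real ^ 'n set) set" where
  "D' s E = {y. (\<forall>a \<in> compl_edges E. y $ a \<in> {0..1}) \<and> (\<forall>a. a \<notin> compl_edges E \<longrightarrow> y $ a = 0) \<and>
     (\<Sum>a\<in>compl_edges E. y $ a) \<le> real s}"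

definition added_matrix :: "'n::finite set set \<Rightarrow> real ^ 'n set \<Rightarrow> real ^ 'n ^ 'n" where
  "added_matrix E y = (\<chi> i j. if {i, j} \<in> compl_edges E then y $ {i, j} else 0)"

definition added_graph :: "'n::finite set set \<Rightarrow> real ^ 'n set \<Rightarrow> 'n set set" where
  "added_graph E y = E \<union> {a \<in> compl_edges E. y $ a = 1}"

definition std_simplex :: "(real ^ 'n::finite) set" where
  "std_simplex = {x. (\<forall>i. 0 \<le> x $ i) \<and> (\<Sum>i\<in>UNIV. x $ i) = 1}"

definition P :: "nat \<Rightarrow> 'n::finite set set \<Rightarrow> ((real ^ 'n) \<times> (real ^ 'n set)) set" where
  "P s E = std_simplex \<times> D' s E"

definition h :: "'n::finite set set \<Rightarrow> real \<Rightarrow> real \<Rightarrow> (real ^ 'n) \<times> (real ^ 'n set) \<Rightarrow> real" where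
  "h E \<alpha> \<beta> = (\<lambda>(x, y). x \<bullet> ((adj_matrix E + added_matrix E y) *v x)
     + \<alpha> / 2 * (norm x)\<^sup>2 + \<beta> / 2 * (norm y)\<^sup>2)"

text \<open>The filter \<^term>\<open>at p within S\<close> consists of the punctured neighbourhoods of \<open>p\<close> in \<open>S\<close>.\<close>

definition local_maximizer_on :: "'a::topological_space set \<Rightarrow> ('a \<Rightarrow> real) \<Rightarrow> 'a \<Rightarrow> bool" where
  "local_maximizer_on S f p \<longleftrightarrow> p \<in> S \<and> (\<forall>\<^sub>F q in at p within S. f q \<le> f p)"

definition strict_local_maximizer_on :: "'a::topological_space set \<Rightarrow> ('a \<Rightarrow> real) \<Rightarrow> 'a \<Rightarrow> bool" where
  "strict_local_maximizer_on S f p \<longleftrightarrow> p \<in> S \<and> (\<forall>\<^sub>F q in at p within S. f q < f p)"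

definition M :: "nat \<Rightarrow> real \<Rightarrow> real \<Rightarrow> 'n::finite set set \<Rightarrow> ((real ^ 'n) \<times> (real ^ 'n set)) set" where
  "M s \<alpha> \<beta> E = {p. strict_local_maximizer_on (P s E) (h E \<alpha> \<beta>) p}"

definition barycenter :: "'n::finite set \<Rightarrow> real ^ 'n" where
  "barycenter C = (1 / real (card C)) *\<^sub>R (\<Sum>i\<in>C. axis i 1)"

text \<open>
  The conditions on \<open>C\<close> and \<open>y\<close> in the combinatorial description of the maximizers. A maximal
  clique is automatically nonempty here, since types are nonempty and singletons are cliques.
\<close>

definition clique_certificate :: "nat \<Rightarrow> 'n::finite set set \<Rightarrow> 'n set \<Rightarrow> real ^ 'n set \<Rightarrow> bool" where
  "clique_certificate s E C y \<longleftrightarrow>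
     y \<in> D s E \<and> real s = (\<Sum>a\<in>compl_edges E. y $ a) \<and>
     defective_clique s C E \<and> maximal_clique C (added_graph E y) \<and>
     (\<forall>a \<in> [C]\<^bsup>2\<^esup> \<inter> compl_edges E. y $ a = 1)"

lemma adj_matrix_added_graph:
  assumes "y \<in> D s E"
  shows "adj_matrix (added_graph E y) = adj_matrix E + added_matrix E y"
  using assms
  by (auto simp: adj_matrix_def added_graph_def added_matrix_def D_def compl_edges_def vec_eq_iff)

lemma norm_D':
  assumes "y \<in> D' s E"
  shows "(norm y)\<^sup>2 = (\<Sum>a\<in>compl_edges E. (y $ a)\<^sup>2)"
proof -
  have "(norm y)\<^sup>2 = (\<Sum>a\<in>UNIV. (y $ a)\<^sup>2)"
    unfolding power2_norm_eq_inner inner_vec_def by (simp add: power2_eq_square)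
  also have "\<dots> = (\<Sum>a\<in>compl_edges E. (y $ a)\<^sup>2)"
    by (rule sum.mono_neutral_right) (use assms in \<open>auto simp: D'_def\<close>)
  finally show ?thesis .
qed

lemma maximal_clique_nonempty:
  assumes "maximal_clique C E"
  shows "C \<noteq> {}"
proof
  fix v :: 'a
  assume "C = {}"
  moreover have "clique {v} E" by (simp add: clique_def)
  ultimately show False using assms by (auto simp: maximal_clique_def)
qed

end

(* In y the function h is strictly convex and nondecreasing, so at a local maximizer the budget is
   exhausted and y is integral; h then becomes the Motzkin-Straus form of the augmented graph, which
   equals 1 - (1 - \<alpha>/2) |x|^2 minus the contribution of the nonadjacent pairs. It is strictly convex
   along the line joining two nonadjacent support vertices, so the support is a clique; equalizing
   two coordinates inside any clique containing the support decreases |x|, which forces x to be the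
   barycenter of a maximal clique. Conversely, near such a point mass outside the clique C costs
   first order, because each outside vertex misses a vertex of C; mass moved inside C costs through
   |x|^2; and a decrease of an added edge costs first order in y, while raising another one, which
   meets the complement of C, gains only second order. *)

theory Submission
  imports Defs
begin

section \<open>Edges, norms and quadratic forms\<close>

lemma doubleton_in_compl_edges:
  "{i, j} \<in> compl_edges E \<longleftrightarrow> i \<noteq> j \<and> {i, j} \<notin> E"
  by (auto simp: compl_edges_def nsets_def card_insert_if)

lemma compl_edges_obtain:
  assumes "a \<in> compl_edges E"
  obtains i j where "i \<noteq> j" "a = {i, j}"
  using assms by (auto simp: compl_edges_def nsets_def card_2_iff)

lemma simple_graph_doubleton:
  assumes "simple_graph E" "{i, j} \<in> E"
  shows "i \<noteq> j"
  using assms by (auto simp: simple_graph_def nsets_def card_insert_if)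

lemma simple_graph_added_graph:
  assumes "simple_graph E"
  shows "simple_graph (added_graph E y)"
  using assms by (auto simp: simple_graph_def added_graph_def compl_edges_def)

lemma power2_norm_vec: "(norm (x :: real ^ 'a))\<^sup>2 = (\<Sum>i\<in>UNIV. (x $ i)\<^sup>2)"
  unfolding power2_norm_eq_inner inner_vec_def by (simp add: power2_eq_square del: dot_square_norm)

lemma power2_norm_add_scaleR:
  fixes x d :: "'a::real_inner"
  shows "(norm (x + t *\<^sub>R d))\<^sup>2 = (norm x)\<^sup>2 + 2 * t * (x \<bullet> d) + t\<^sup>2 * (norm d)\<^sup>2"
  unfolding power2_norm_eq_inner
  by (simp add: inner_simps inner_commute power2_eq_square algebra_simps del: dot_square_norm)

lemma inner_matrix_vector:
  fixes A :: "real ^ 'n ^ 'n"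
  shows "x \<bullet> (A *v x) = (\<Sum>i\<in>UNIV. \<Sum>j\<in>UNIV. A $ i $ j * x $ i * x $ j)"
  by (simp add: inner_vec_def matrix_vector_mult_def sum_distrib_left algebra_simps)

section \<open>The regularized Motzkin-Straus form\<close>

definition nonadjacent_form :: "'n::finite set set \<Rightarrow> real ^ 'n \<Rightarrow> real" where
  "nonadjacent_form F x = (\<Sum>i\<in>UNIV. \<Sum>j\<in>UNIV. if i \<noteq> j \<and> {i, j} \<notin> F then x $ i * x $ j else 0)"

definition motzkin_straus :: "'n::finite set set \<Rightarrow> real \<Rightarrow> real ^ 'n \<Rightarrow> real" where
  "motzkin_straus F \<alpha> x = x \<bullet> (adj_matrix F *v x) + \<alpha> / 2 * (norm x)\<^sup>2"

text \<open>An adjacency matrix is the all-ones matrix minus the identity minus the adjacency matrix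
  of the complement. On the simplex the first square equals 1, so only the norm and the nonadjacent
  pairs matter there.\<close>

lemma motzkin_straus_eq:
  assumes "simple_graph F"
  shows "motzkin_straus F \<alpha> x =
    (\<Sum>i\<in>UNIV. x $ i)\<^sup>2 - (1 - \<alpha> / 2) * (norm x)\<^sup>2 - nonadjacent_form F x"
proof -
  have split: "adj_matrix F $ i $ j * x $ i * x $ j = x $ i * x $ j
      - (if i = j then (x $ i)\<^sup>2 else 0) - (if i \<noteq> j \<and> {i, j} \<notin> F then x $ i * x $ j else 0)"
    for i j
    using simple_graph_doubleton[OF assms, of i j]
    by (auto simp: adj_matrix_def power2_eq_square)
  have "x \<bullet> (adj_matrix F *v x) = (\<Sum>i\<in>UNIV. \<Sum>j\<in>UNIV. x $ i * x $ j)
      - (\<Sum>i\<in>UNIV. \<Sum>j\<in>UNIV. if i = j then (x $ i)\<^sup>2 else 0) - nonadjacent_form F x"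
    unfolding inner_matrix_vector split nonadjacent_form_def by (simp add: sum_subtractf)
  also have "\<dots> = (\<Sum>i\<in>UNIV. x $ i)\<^sup>2 - (norm x)\<^sup>2 - nonadjacent_form F x"
    by (simp add: power2_norm_vec) (simp add: power2_eq_square sum_product)
  finally show ?thesis
    unfolding motzkin_straus_def by (simp add: algebra_simps)
qed

text \<open>This is the parallelogram identity of a quadratic form: the first-order terms cancel. A
  positive value at \<open>d\<close> thus rules out a local maximum from which both directions along
  \<open>d\<close> are feasible.\<close>

lemma motzkin_straus_second_difference:
  "motzkin_straus F \<alpha> (x + t *\<^sub>R d) + motzkin_straus F \<alpha> (x - t *\<^sub>R d) =
   2 * motzkin_straus F \<alpha> x + 2 * t\<^sup>2 * motzkin_straus F \<alpha> d"
proof -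
  have minus: "x - t *\<^sub>R d = x + (- t) *\<^sub>R d"
    by simp
  show ?thesis
    unfolding minus motzkin_straus_def power2_norm_add_scaleR
    by (simp add: matrix_vector_right_distrib matrix_vector_mult_scaleR
        matrix_vector_mult_diff_distrib inner_simps power2_eq_square[of t] algebra_simps)
qed

text \<open>All four matrix entries that the direction meets vanish, so only the regularization
  remains, and it makes the curvature positive when \<alpha> is.\<close>

lemma motzkin_straus_axis_diff:
  assumes "simple_graph F" "i \<noteq> j" "{i, j} \<notin> F"
  shows "motzkin_straus F \<alpha> (axis i 1 - axis j 1) = \<alpha>"
proof -
  let ?d = "axis i 1 - axis j 1 :: real ^ 'a"
  have "adj_matrix F $ i $ i = 0" "adj_matrix F $ j $ j = 0"
      "adj_matrix F $ i $ j = 0" "adj_matrix F $ j $ i = 0"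
    using assms simple_graph_doubleton[OF assms(1), of i i] simple_graph_doubleton[OF assms(1), of j j]
    by (auto simp: adj_matrix_def insert_commute)
  then have "?d \<bullet> (adj_matrix F *v ?d) = 0"
    by (simp add: matrix_vector_mult_diff_distrib matrix_vector_mul_component[symmetric]
        inner_diff_left inner_axis' matrix_vector_mult_basis column_def)
  moreover have "(norm ?d)\<^sup>2 = 2"
    using assms(2)
    by (simp add: power2_norm_eq_inner inner_simps inner_axis_axis)
  ultimately show ?thesis
    by (simp add: motzkin_straus_def)
qed

lemma nonadjacent_form_clique:
  assumes "clique C F" "\<And>i. i \<notin> C \<Longrightarrow> x $ i = 0"
  shows "nonadjacent_form F x = 0"
  unfolding nonadjacent_form_def
  by (intro sum.neutral ballI) (use assms in \<open>auto simp: clique_def\<close>)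

section \<open>Barycenters of cliques\<close>

lemma barycenter_nth: "barycenter C $ i = (if i \<in> C then 1 / real (card C) else 0)"
  by (simp add: barycenter_def axis_def)

lemma sum_barycenter:
  assumes "C \<noteq> {}"
  shows "(\<Sum>i\<in>UNIV. barycenter C $ i) = 1"
  using assms by (simp add: barycenter_nth sum.If_cases)

lemma norm_barycenter: "(norm (barycenter C))\<^sup>2 = 1 / real (card C)"
proof -
  have "(norm (barycenter C))\<^sup>2 = (\<Sum>i\<in>UNIV. if i \<in> C then (1 / real (card C))\<^sup>2 else 0)"
    unfolding power2_norm_vec by (rule sum.cong) (auto simp: barycenter_nth)
  also have "\<dots> = 1 / real (card C)"
    by (simp add: sum.If_cases power2_eq_square)
  finally show ?thesis .
qed

lemma motzkin_straus_barycenter: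
  assumes "simple_graph F" "clique C F" "C \<noteq> {}"
  shows "motzkin_straus F \<alpha> (barycenter C) = 1 - (1 - \<alpha> / 2) / real (card C)"
proof -
  have "nonadjacent_form F (barycenter C) = 0"
    by (rule nonadjacent_form_clique[OF assms(2)]) (simp add: barycenter_nth)
  then show ?thesis
    by (simp add: motzkin_straus_eq[OF assms(1)] sum_barycenter[OF assms(3)] norm_barycenter)
qed

section \<open>Local maximizers along lines and in product factors\<close>

lemma eventually_local_maximizer:
  fixes p d :: "'a::real_normed_vector"
  assumes "local_maximizer_on S f p"
  shows "\<forall>\<^sub>F t in at_right 0. p + t *\<^sub>R d \<in> S \<longrightarrow> f (p + t *\<^sub>R d) \<le> f p"
proof -
  \<comment> \<open>The exclusion of \<open>p\<close> becomes a premise, since a zero direction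
    keeps the line at \<open>p\<close>; there the inequality is trivial.\<close>
  have "\<forall>\<^sub>F q in nhds p. q \<noteq> p \<longrightarrow> q \<in> S \<longrightarrow> f q \<le> f p"
    using assms unfolding local_maximizer_on_def eventually_at_filter by blast
  moreover have "((\<lambda>t. p + t *\<^sub>R d) \<longlongrightarrow> p) (at_right 0)"
    by (auto intro!: tendsto_eq_intros)
  ultimately have "\<forall>\<^sub>F t in at_right 0.
      p + t *\<^sub>R d \<noteq> p \<longrightarrow> p + t *\<^sub>R d \<in> S \<longrightarrow> f (p + t *\<^sub>R d) \<le> f p"
    unfolding filterlim_iff by blast
  then show ?thesis
    by (rule eventually_mono) force
qed

text \<open>One step length serves both directions, as second differences require. Feasibility stays
  a premise; the bound \<open>c\<close> is chosen at each use to ensure it.\<close>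

lemma local_maximizer_step:
  fixes p d :: "'a::real_normed_vector"
  assumes "local_maximizer_on S f p" "0 < c"
  obtains t where "0 < t" "t < c"
    "p + t *\<^sub>R d \<in> S \<Longrightarrow> f (p + t *\<^sub>R d) \<le> f p"
    "p - t *\<^sub>R d \<in> S \<Longrightarrow> f (p - t *\<^sub>R d) \<le> f p"
proof -
  have "\<forall>\<^sub>F t in at_right 0. 0 < t \<and> t < c"
    using assms(2) by (auto simp: eventually_at_right_field)
  from eventually_conj[OF this eventually_conj[OF eventually_local_maximizer[OF assms(1), of d]
        eventually_local_maximizer[OF assms(1), of "- d"]]]
  have "\<forall>\<^sub>F t in at_right 0. (0 < t \<and> t < c)
      \<and> (p + t *\<^sub>R d \<in> S \<longrightarrow> f (p + t *\<^sub>R d) \<le> f p)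
      \<and> (p + t *\<^sub>R (- d) \<in> S \<longrightarrow> f (p + t *\<^sub>R (- d)) \<le> f p)" .
  from eventually_happens'[OF trivial_limit_at_right_real this]
  obtain t where "0 < t" "t < c"
    "p + t *\<^sub>R d \<in> S \<longrightarrow> f (p + t *\<^sub>R d) \<le> f p"
    "p + t *\<^sub>R (- d) \<in> S \<longrightarrow> f (p + t *\<^sub>R (- d)) \<le> f p"
    by blast
  then show thesis
    by (intro that[of t]) auto
qed

text \<open>The slice map is injective, so it carries punctured neighbourhoods into punctured
  neighbourhoods. This allows \<open>x\<close> and \<open>y\<close> to be treated
  separately.\<close>

lemma local_maximizer_on_fst:
  assumes "local_maximizer_on (S \<times> T) f (x, y)"
  shows "local_maximizer_on S (\<lambda>x. f (x, y)) x"
proof -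
  have xy: "x \<in> S" "y \<in> T"
    using assms by (auto simp: local_maximizer_on_def)
  have "filterlim (\<lambda>x. (x, y)) (at (x, y) within S \<times> T) (at x within S)"
    using xy by (auto simp: filterlim_at eventually_at_filter intro!: tendsto_intros)
  then show ?thesis
    using assms xy unfolding local_maximizer_on_def filterlim_iff by blast
qed

lemma local_maximizer_on_snd:
  assumes "local_maximizer_on (S \<times> T) f (x, y)"
  shows "local_maximizer_on T (\<lambda>y. f (x, y)) y"
proof -
  have xy: "x \<in> S" "y \<in> T"
    using assms by (auto simp: local_maximizer_on_def)
  have "filterlim (\<lambda>y. (x, y)) (at (x, y) within S \<times> T) (at y within T)"
    using xy by (auto simp: filterlim_at eventually_at_filter intro!: tendsto_intros)
  then show ?thesis
    using assms xy unfolding local_maximizer_on_def filterlim_iff by blast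
qed

lemma strict_local_maximizer_on_imp_local_maximizer_on:
  assumes "strict_local_maximizer_on S f p"
  shows "local_maximizer_on S f p"
  using assms unfolding strict_local_maximizer_on_def local_maximizer_on_def
  by (auto elim: eventually_mono)

section \<open>Local maximizers of the Motzkin-Straus form\<close>

lemma local_maximizer_on_motzkin_straus:
  fixes F :: "'n::finite set set"
  assumes F: "simple_graph F" and \<alpha>: "0 < \<alpha>" "\<alpha> < 2"
    and max: "local_maximizer_on std_simplex (motzkin_straus F \<alpha>) x"
  shows "\<exists>C. maximal_clique C F \<and> x = barycenter C"
proof -
  define C where "C = {i. x $ i \<noteq> 0}"
  have x: "\<And>i. 0 \<le> x $ i" and sum_x: "(\<Sum>i\<in>UNIV. x $ i) = 1"
    using max by (auto simp: local_maximizer_on_def std_simplex_def)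
  have sum_shift: "(\<Sum>k\<in>UNIV. (x + t *\<^sub>R (axis i 1 - axis j 1)) $ k) = 1" for t i j
    using sum_x by (simp add: sum.distrib sum_subtractf sum_distrib_left[symmetric] axis_def)
  \<comment> \<open>Only nonnegativity at \<open>j\<close> can fail, because \<open>j\<close> is the
    vertex that gives up mass.\<close>
  have shift: "x + t *\<^sub>R (axis i 1 - axis j 1) \<in> std_simplex" if "0 \<le> t" "t \<le> x $ j" for t i j
    using that x sum_shift[of t i j] by (auto simp: std_simplex_def axis_def)
  have clique_C: "clique C F"
    unfolding clique_def
  proof (intro ballI impI, rule ccontr)
    fix i j assume ij: "i \<in> C" "j \<in> C" "i \<noteq> j" "{i, j} \<notin> F"
    let ?d = "axis i 1 - axis j 1 :: real ^ 'n"
    have pos: "0 < min (x $ i) (x $ j)"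
      using ij x[of i] x[of j] by (auto simp: C_def)
    obtain t where t: "0 < t" "t < min (x $ i) (x $ j)"
      "x + t *\<^sub>R ?d \<in> std_simplex \<Longrightarrow> motzkin_straus F \<alpha> (x + t *\<^sub>R ?d) \<le> motzkin_straus F \<alpha> x"
      "x - t *\<^sub>R ?d \<in> std_simplex \<Longrightarrow> motzkin_straus F \<alpha> (x - t *\<^sub>R ?d) \<le> motzkin_straus F \<alpha> x"
      using local_maximizer_step[OF max pos, of ?d] by blast
    have minus: "x - t *\<^sub>R ?d = x + t *\<^sub>R (axis j 1 - axis i 1)"
      by (simp add: algebra_simps)
    have "x + t *\<^sub>R ?d \<in> std_simplex" "x - t *\<^sub>R ?d \<in> std_simplex"
      unfolding minus using t(1,2) shift[of t i j] shift[of t j i] by auto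
    \<comment> \<open>Neither neighbour exceeds the value at \<open>x\<close>, so the second
      difference is nonpositive, although \<alpha> makes it positive.\<close>
    with t(3,4) have "2 * t\<^sup>2 * motzkin_straus F \<alpha> ?d \<le> 0"
      using motzkin_straus_second_difference[of F \<alpha> x t ?d] by simp
    then show False
      using t(1) \<alpha>(1) motzkin_straus_axis_diff[OF F ij(3,4)] by (simp add: mult_le_0_iff)
  qed
  \<comment> \<open>The clique \<open>K\<close> is kept general: \<open>K = C\<close> makes the
    coordinates on the support equal, and a larger \<open>K\<close> yields a contradiction to prove
    maximality.\<close>
  have le_on_clique: "x $ i \<le> x $ j" if K: "clique K F" "C \<subseteq> K" "i \<in> K" "j \<in> K" for K i j
  proof (rule ccontr)
    assume "\<not> ?thesis"
    then have less: "0 < x $ i - x $ j"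
      by simp
    let ?d = "axis j 1 - axis i 1 :: real ^ 'n"
    obtain t where t: "0 < t" "t < x $ i - x $ j"
      "x + t *\<^sub>R ?d \<in> std_simplex \<Longrightarrow> motzkin_straus F \<alpha> (x + t *\<^sub>R ?d) \<le> motzkin_straus F \<alpha> x"
      using local_maximizer_step[OF max less, of ?d] by metis
    have "nonadjacent_form F x = 0" "nonadjacent_form F (x + t *\<^sub>R ?d) = 0"
      using K by (auto intro!: nonadjacent_form_clique[OF K(1)] simp: C_def axis_def)
    moreover have "x + t *\<^sub>R ?d \<in> std_simplex"
      using t(1,2) x[of j] by (intro shift) auto
    ultimately have "(1 - \<alpha> / 2) * (norm x)\<^sup>2 \<le> (1 - \<alpha> / 2) * (norm (x + t *\<^sub>R ?d))\<^sup>2"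
      using t(3) unfolding motzkin_straus_eq[OF F] sum_shift sum_x by simp
    then have "0 \<le> 2 * t * (x \<bullet> ?d) + t\<^sup>2 * (norm ?d)\<^sup>2"
      using \<alpha>(2) by (simp add: power2_norm_add_scaleR)
    moreover have "(norm ?d)\<^sup>2 = 2"
      using less by (auto simp: power2_norm_eq_inner inner_simps inner_axis_axis simp del: dot_square_norm)
    moreover have "x \<bullet> ?d = x $ j - x $ i"
      by (simp add: inner_diff_right inner_axis)
    \<comment> \<open>With gap g = \<open>x $ i - x $ j\<close> the squared norm changes by 2 t (t -
      g), which is negative for 0 < t < g. Hence the step bound above.\<close>
    ultimately have "0 \<le> 2 * t * (x $ j - x $ i) + t\<^sup>2 * 2"
      by simp
    then have "0 \<le> 2 * (t * (t - (x $ i - x $ j)))"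
      by (simp add: power2_eq_square algebra_simps)
    then show False
      using t(1,2) by (simp add: zero_le_mult_iff)
  qed
  obtain k where k: "k \<in> C"
    using sum_x sum.neutral[of UNIV "($) x"] by (force simp: C_def)
  have "\<not> C \<subset> K" if K: "clique K F" for K
  proof
    assume CK: "C \<subset> K"
    then obtain j where "j \<in> K" "j \<notin> C"
      by blast
    \<comment> \<open>A vertex \<open>j\<close> off the support has weight 0, and this would bound
      the weight of the support vertex \<open>k\<close>.\<close>
    then have "x $ k \<le> 0"
      using le_on_clique[OF K, of k j] CK k by (auto simp: C_def)
    then show False
      using k x[of k] by (simp add: C_def)
  qed
  then have "maximal_clique C F"
    using clique_C by (simp add: maximal_clique_def)
  moreover have "x = barycenter C"
  proof -
    have xi: "x $ i = (if i \<in> C then x $ k else 0)" for i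
      using le_on_clique[OF clique_C subset_refl, of i k] le_on_clique[OF clique_C subset_refl, of k i] k
      by (auto simp: C_def)
    have "(\<Sum>i\<in>UNIV. x $ i) = (\<Sum>i\<in>UNIV. if i \<in> C then x $ k else 0)"
      by (rule sum.cong) (use xi in auto)
    then have "real (card C) * x $ k = 1"
      using sum_x by (simp add: sum.If_cases)
    then have "x $ k = 1 / real (card C)"
      by (cases "card C = 0") (auto simp: field_simps)
    then show ?thesis
      using xi by (simp add: vec_eq_iff barycenter_nth)
  qed
  ultimately show ?thesis
    by blast
qed

section \<open>Dependence on the edge weights and integrality\<close>

lemma added_matrix_zero [simp]: "added_matrix E 0 = 0"
  by (simp add: added_matrix_def vec_eq_iff)

text \<open>The integral \<open>y\<close> is a base point that fixes the graph, while
  \<open>y'\<close> is free. The middle term vanishes for \<open>y' = y\<close>; in general the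
  comparison with a point over \<open>y\<close> splits into one inequality for the vertex weights
  and one for the edge weights.\<close>

lemma h_eq_motzkin_straus:
  assumes "y \<in> D s E"
  shows "h E \<alpha> \<beta> (x, y') = motzkin_straus (added_graph E y) \<alpha> x
    + x \<bullet> (added_matrix E (y' - y) *v x) + \<beta> / 2 * (norm y')\<^sup>2"
proof -
  have "added_matrix E y' = added_matrix E y + added_matrix E (y' - y)"
    by (simp add: added_matrix_def vec_eq_iff)
  then show ?thesis
    by (simp add: h_def motzkin_straus_def adj_matrix_added_graph[OF assms]
        matrix_vector_mult_add_rdistrib inner_simps)
qed

lemma D_subset_D': "D s E \<subseteq> D' s E"
  by (force simp: D_def D'_def)

lemma added_matrix_form_add:
  "x \<bullet> (added_matrix E (y + t *\<^sub>R z) *v x) =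
   x \<bullet> (added_matrix E y *v x) + t * (x \<bullet> (added_matrix E z *v x))"
proof -
  have "added_matrix E (y + t *\<^sub>R z) = added_matrix E y + t *\<^sub>R added_matrix E z"
    by (simp add: added_matrix_def vec_eq_iff)
  then show ?thesis
    by (simp add: matrix_vector_mult_add_rdistrib scaleR_matrix_vector_assoc[symmetric] inner_simps)
qed

text \<open>The expansion is exact because \<open>h\<close> is quadratic in \<open>y\<close>. For
  \<beta> > 0 its last term expresses strict convexity.\<close>

lemma h_add_snd:
  "h E \<alpha> \<beta> (x, y + t *\<^sub>R z) = h E \<alpha> \<beta> (x, y)
    + t * (x \<bullet> (added_matrix E z *v x) + \<beta> * (y \<bullet> z)) + \<beta> / 2 * t\<^sup>2 * (norm z)\<^sup>2"
  unfolding h_def prod.case matrix_vector_mult_add_rdistrib inner_add_right added_matrix_form_add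
    power2_norm_add_scaleR
  by (simp add: algebra_simps)

lemma added_matrix_form_nonneg:
  assumes "\<And>i. 0 \<le> x $ i" "\<And>a. 0 \<le> y $ a"
  shows "0 \<le> x \<bullet> (added_matrix E y *v x)"
  unfolding inner_matrix_vector by (intro sum_nonneg) (simp add: added_matrix_def assms)

text \<open>With slack in the budget, raising a component below 1 increases \<open>h\<close>. Once
  the budget is tight, a fractional component has a fractional partner, and convexity forbids a
  maximum on the segment that exchanges mass between them.\<close>

lemma local_maximizer_on_D':
  fixes E :: "'n::finite set set"
  assumes s: "s \<le> card (compl_edges E)" and \<beta>: "0 < \<beta>" and x: "\<And>i. 0 \<le> x $ i"
    and max: "local_maximizer_on (D' s E) (\<lambda>y. h E \<alpha> \<beta> (x, y)) y"
  shows "y \<in> D s E \<and> (\<Sum>a\<in>compl_edges E. y $ a) = real s"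
proof -
  let ?N = "compl_edges E"
  have y: "\<And>a. a \<in> ?N \<Longrightarrow> 0 \<le> y $ a \<and> y $ a \<le> 1" "\<And>a. a \<notin> ?N \<Longrightarrow> y $ a = 0"
    and le: "(\<Sum>a\<in>?N. y $ a) \<le> real s"
    using max by (auto simp: local_maximizer_on_def D'_def)
  have sum_y: "(\<Sum>a\<in>?N. y $ a) = real s"
  proof (rule ccontr)
    assume "\<not> ?thesis"
    then have less: "(\<Sum>a\<in>?N. y $ a) < real s"
      using le by simp
    \<comment> \<open>Otherwise the sum would reach the number of non-edges, which is at least
      \<open>s\<close>.\<close>
    have "\<exists>a\<in>?N. y $ a < 1"
    proof (rule ccontr)
      assume "\<not> ?thesis"
      then have "(\<Sum>a\<in>?N. 1) \<le> (\<Sum>a\<in>?N. y $ a)"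
        by (intro sum_mono) auto
      then show False
        using less s by simp
    qed
    then obtain a where a: "a \<in> ?N" "y $ a < 1"
      by blast
    let ?z = "axis a 1 :: real ^ 'n set"
    have pos: "0 < min (1 - y $ a) (real s - (\<Sum>a\<in>?N. y $ a))"
      using a less by simp
    obtain t where t: "0 < t" "t < min (1 - y $ a) (real s - (\<Sum>a\<in>?N. y $ a))"
      "y + t *\<^sub>R ?z \<in> D' s E \<Longrightarrow> h E \<alpha> \<beta> (x, y + t *\<^sub>R ?z) \<le> h E \<alpha> \<beta> (x, y)"
      using local_maximizer_step[OF max pos, of ?z] by metis
    have "(\<Sum>b\<in>?N. (y + t *\<^sub>R ?z) $ b) = (\<Sum>b\<in>?N. y $ b) + t"
      using a by (simp add: sum.distrib sum_distrib_left[symmetric] axis_def)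
    then have "y + t *\<^sub>R ?z \<in> D' s E"
      using a t(1,2) y by (auto simp: D'_def axis_def)
    then have "t * (x \<bullet> (added_matrix E ?z *v x) + \<beta> * (y \<bullet> ?z)) + \<beta> / 2 * t\<^sup>2 * (norm ?z)\<^sup>2 \<le> 0"
      using t(3) by (simp add: h_add_snd)
    \<comment> \<open>The first-order term may vanish, for instance if \<open>y $ a\<close> is 0 and
      \<open>x\<close> has no mass on an endpoint; strictness comes from the quadratic term.\<close>
    moreover have "0 \<le> t * (x \<bullet> (added_matrix E ?z *v x) + \<beta> * (y \<bullet> ?z))"
      using t(1) \<beta> y(1)[OF a(1)] x
      by (intro mult_nonneg_nonneg add_nonneg_nonneg added_matrix_form_nonneg)
        (auto simp: inner_axis, simp add: axis_def)
    moreover have "0 < \<beta> / 2 * t\<^sup>2 * (norm ?z)\<^sup>2"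
      using t(1) \<beta> by simp
    ultimately show False
      by linarith
  qed
  have "y $ a \<in> {0, 1}" if a: "a \<in> ?N" for a
  proof (rule ccontr)
    assume "\<not> ?thesis"
    then have frac_a: "0 < y $ a" "y $ a < 1"
      using y(1)[OF a] by auto
    \<comment> \<open>A single fractional component cannot occur because the total \<open>s\<close>
      is an integer.\<close>
    have "\<exists>b\<in>?N - {a}. y $ b \<notin> {0, 1}"
    proof (rule ccontr)
      assume "\<not> ?thesis"
      then have "\<forall>b\<in>?N - {a}. y $ b \<in> \<int>"
        by force
      then have "(\<Sum>b\<in>?N - {a}. y $ b) \<in> \<int>"
        by (intro Ints_sum) auto
      moreover have "y $ a = real s - (\<Sum>b\<in>?N - {a}. y $ b)"
        using sum_y a by (simp add: sum.remove)
      ultimately have "y $ a \<in> \<int>"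
        by (simp add: Ints_diff)
      then show False
        using frac_a by (auto elim!: Ints_cases)
    qed
    then obtain b where b: "b \<in> ?N" "b \<noteq> a" and frac_b: "0 < y $ b" "y $ b < 1"
      using y(1) by (force simp: less_le)
    let ?z = "axis a 1 - axis b 1 :: real ^ 'n set"
    let ?c = "min (min (y $ a) (1 - y $ a)) (min (y $ b) (1 - y $ b))"
    have pos: "0 < ?c"
      using frac_a frac_b by simp
    obtain t where t: "0 < t" "t < ?c"
      "y + t *\<^sub>R ?z \<in> D' s E \<Longrightarrow> h E \<alpha> \<beta> (x, y + t *\<^sub>R ?z) \<le> h E \<alpha> \<beta> (x, y)"
      "y - t *\<^sub>R ?z \<in> D' s E \<Longrightarrow> h E \<alpha> \<beta> (x, y - t *\<^sub>R ?z) \<le> h E \<alpha> \<beta> (x, y)"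
      using local_maximizer_step[OF max pos, of ?z] by blast
    have "(\<Sum>c\<in>?N. (y + u *\<^sub>R ?z) $ c) = real s" for u
      using a b sum_y
      by (simp add: sum.distrib sum_subtractf sum_distrib_left[symmetric] axis_def)
    from this[of t] this[of "- t"]
    have "y + t *\<^sub>R ?z \<in> D' s E" "y + (- t) *\<^sub>R ?z \<in> D' s E"
      using a b t(1,2) y by (auto simp: D'_def axis_def)
    \<comment> \<open>Adding the expansions for \<open>t\<close> and \<open>- t\<close> cancels the
      first-order terms.\<close>
    then have "\<beta> / 2 * t\<^sup>2 * (norm ?z)\<^sup>2 \<le> 0"
      using t(3,4) h_add_snd[of E \<alpha> \<beta> x y t ?z] h_add_snd[of E \<alpha> \<beta> x y "- t" ?z]
      by simp
    moreover have "?z \<noteq> 0"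
      using b by (simp add: axis_eq_axis)
    ultimately show False
      using t(1) \<beta> by (simp add: mult_le_0_iff)
  qed
  then show ?thesis
    using y(2) sum_y by (auto simp: D_def)
qed

section \<open>Strict local maximality at a maximal clique\<close>

text \<open>By maximality every vertex outside \<open>C\<close> misses some vertex of
  \<open>C\<close>, whose weight is at least \<open>b\<close>. The form sums over ordered pairs,
  hence the factor 2.\<close>

lemma nonadjacent_form_lower:
  fixes F :: "'n::finite set set"
  assumes C: "maximal_clique C F" and nonneg: "\<And>i. 0 \<le> x $ i" and lower: "\<And>i. i \<in> C \<Longrightarrow> b \<le> x $ i"
  shows "2 * b * (\<Sum>v\<in>- C. x $ v) \<le> nonadjacent_form F x"
proof -
  define g where "g = (\<lambda>i j. if i \<noteq> j \<and> {i, j} \<notin> F then x $ i * x $ j else 0)"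
  have g_nonneg: "0 \<le> g i j" for i j
    using nonneg by (simp add: g_def)
  have g_commute: "g i j = g j i" for i j
    by (auto simp: g_def insert_commute mult.commute)
  have half: "b * (\<Sum>v\<in>- C. x $ v) \<le> (\<Sum>v\<in>- C. \<Sum>j\<in>C. g v j)"
    unfolding sum_distrib_left
  proof (rule sum_mono)
    fix v assume v: "v \<in> - C"
    have "\<not> clique (insert v C) F"
      using C v by (auto simp: maximal_clique_def)
    then obtain j where j: "j \<in> C" "{v, j} \<notin> F"
      using C v by (auto simp: maximal_clique_def clique_def insert_commute)
    have "b * x $ v \<le> g v j"
      using lower[OF j(1)] nonneg[of v] v j by (auto simp: g_def mult.commute[of "x $ v"] intro: mult_right_mono)
    also have "\<dots> \<le> (\<Sum>j\<in>C. g v j)"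
      using j(1) by (intro member_le_sum) (auto simp: g_nonneg)
    finally show "b * x $ v \<le> (\<Sum>j\<in>C. g v j)" .
  qed
  have split: "sum f UNIV = sum f C + sum f (- C)" for f :: "'n \<Rightarrow> real"
    using sum.union_disjoint[of C "- C" f] by simp
  have "(\<Sum>i\<in>C. \<Sum>v\<in>- C. g i v) = (\<Sum>v\<in>- C. \<Sum>j\<in>C. g v j)"
    by (subst sum.swap) (simp add: g_commute)
  then have "2 * (b * (\<Sum>v\<in>- C. x $ v)) \<le> (\<Sum>i\<in>C. \<Sum>v\<in>- C. g i v) + (\<Sum>v\<in>- C. \<Sum>j\<in>C. g v j)"
    using half by simp
  \<comment> \<open>Only the two mixed blocks between \<open>C\<close> and its complement are kept;
    the others are nonnegative.\<close>
  also have "\<dots> \<le> (\<Sum>i\<in>UNIV. \<Sum>j\<in>UNIV. g i j)"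
    unfolding split[of "\<lambda>i. \<Sum>j\<in>UNIV. g i j"]
    by (intro add_mono sum_mono sum_mono2) (auto simp: g_nonneg)
  also have "\<dots> = nonadjacent_form F x"
    by (simp add: nonadjacent_form_def g_def)
  finally show ?thesis
    by simp
qed

text \<open>Let c = \<open>card C\<close> and let m be the mass outside \<open>C\<close>. Moving it
  there can relieve the norm penalty by (2 - \<alpha>) m / c to first order, but costs at least 2
  (1/c - \<epsilon>) m in nonadjacent pairs. The difference is the linear term of the bound; the
  squares measure unevenness inside \<open>C\<close>.\<close>

lemma motzkin_straus_upper:
  fixes F :: "'n::finite set set"
  assumes F: "simple_graph F" and C: "maximal_clique C F" and \<alpha>: "\<alpha> < 2"
    and x: "x \<in> std_simplex" and close: "\<And>i. i \<in> C \<Longrightarrow> barycenter C $ i - \<epsilon> \<le> x $ i"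
  shows "motzkin_straus F \<alpha> x \<le> motzkin_straus F \<alpha> (barycenter C)
    - 2 * (\<alpha> / (2 * real (card C)) - \<epsilon>) * (\<Sum>v\<in>- C. x $ v)
    - (1 - \<alpha> / 2) * (\<Sum>i\<in>C. (x $ i - 1 / real (card C))\<^sup>2)"
proof -
  define c where "c = real (card C)"
  define m where "m = (\<Sum>v\<in>- C. x $ v)"
  define S where "S = (\<Sum>i\<in>C. (x $ i - 1 / c)\<^sup>2)"
  have ne: "C \<noteq> {}"
    using C by (rule maximal_clique_nonempty)
  then have c: "0 < c"
    by (simp add: c_def card_gt_0_iff)
  have nonneg: "\<And>i. 0 \<le> x $ i" and sum_x: "(\<Sum>i\<in>UNIV. x $ i) = 1"
    using x by (auto simp: std_simplex_def)
  have sum_C: "(\<Sum>i\<in>C. x $ i) = 1 - m"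
    using sum.union_disjoint[of C "- C" "($) x"] sum_x by (simp add: m_def)
  \<comment> \<open>Expanding the squares about 1/c and using that \<open>C\<close> carries mass 1 -
    m recovers the norm on \<open>C\<close> from \<open>S\<close> and \<open>m\<close>.\<close>
  have "S = (\<Sum>i\<in>C. (x $ i)\<^sup>2 - 2 / c * x $ i + 1 / c\<^sup>2)"
    unfolding S_def by (rule sum.cong) (auto simp: power2_diff power_divide)
  also have "\<dots> = (\<Sum>i\<in>C. (x $ i)\<^sup>2) - 2 / c * (1 - m) + c * (1 / c\<^sup>2)"
    by (simp add: sum.distrib sum_subtractf sum_distrib_left[symmetric] sum_C c_def
        del: times_divide_eq_left)
  also have "\<dots> = (\<Sum>i\<in>C. (x $ i)\<^sup>2) - 1 / c + 2 * m / c"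
    using c by (simp add: field_simps power2_eq_square)
  finally have "1 / c - 2 * m / c + S = (\<Sum>i\<in>C. (x $ i)\<^sup>2)"
    by simp
  also have "\<dots> \<le> (norm x)\<^sup>2"
    unfolding power2_norm_vec by (rule sum_mono2) auto
  finally have "(1 - \<alpha> / 2) * (1 / c - 2 * m / c + S) \<le> (1 - \<alpha> / 2) * (norm x)\<^sup>2"
    using \<alpha> by (intro mult_left_mono) auto
  moreover have "2 * (1 / c - \<epsilon>) * m \<le> nonadjacent_form F x"
    unfolding m_def using close
    by (intro nonadjacent_form_lower[OF C nonneg]) (auto simp: barycenter_nth c_def)
  moreover have "motzkin_straus F \<alpha> (barycenter C) = 1 - (1 - \<alpha> / 2) / c"
    using motzkin_straus_barycenter[OF F _ ne] C by (simp add: maximal_clique_def c_def)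
  moreover have "1 - (1 - \<alpha> / 2) * (1 / c - 2 * m / c + S) - 2 * (1 / c - \<epsilon>) * m
      = 1 - (1 - \<alpha> / 2) / c - 2 * (\<alpha> / (2 * c) - \<epsilon>) * m - (1 - \<alpha> / 2) * S"
    using c by (simp add: field_simps)
  ultimately show ?thesis
    unfolding motzkin_straus_eq[OF F, of \<alpha> x] sum_x c_def[symmetric] m_def[symmetric] S_def[symmetric]
    by simp
qed

text \<open>The two losses in the upper bound are nonnegative, have positive coefficients and vanish
  together only at the barycenter.\<close>

lemma motzkin_straus_strict_local_maximum:
  fixes F :: "'n::finite set set"
  assumes F: "simple_graph F" and C: "maximal_clique C F" and \<alpha>: "\<alpha> < 2"
    and x: "x \<in> std_simplex" and close: "\<And>i. i \<in> C \<Longrightarrow> barycenter C $ i - \<epsilon> \<le> x $ i"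
    and \<epsilon>: "\<epsilon> < \<alpha> / (2 * real (card C))" and ne: "x \<noteq> barycenter C"
  shows "motzkin_straus F \<alpha> x < motzkin_straus F \<alpha> (barycenter C)"
proof -
  have nonneg: "\<And>i. 0 \<le> x $ i"
    using x by (auto simp: std_simplex_def)
  have "0 < (\<Sum>v\<in>- C. x $ v) \<or> 0 < (\<Sum>i\<in>C. (x $ i - 1 / real (card C))\<^sup>2)"
  proof (rule ccontr)
    assume "\<not> ?thesis"
    then have "(\<Sum>v\<in>- C. x $ v) = 0" "(\<Sum>i\<in>C. (x $ i - 1 / real (card C))\<^sup>2) = 0"
      using sum_nonneg[of "- C" "($) x"] sum_nonneg[of C "\<lambda>i. (x $ i - 1 / real (card C))\<^sup>2"] nonneg
      by auto
    then have "\<forall>v\<in>- C. x $ v = 0" "\<forall>i\<in>C. x $ i = 1 / real (card C)"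
      using nonneg by (auto simp: sum_nonneg_eq_0_iff)
    then show False
      using ne by (auto simp: vec_eq_iff barycenter_nth split: if_splits)
  qed
  moreover have "0 \<le> (\<Sum>v\<in>- C. x $ v)" "0 \<le> (\<Sum>i\<in>C. (x $ i - 1 / real (card C))\<^sup>2)"
    using nonneg by (auto intro: sum_nonneg)
  ultimately have "0 < 2 * (\<alpha> / (2 * real (card C)) - \<epsilon>) * (\<Sum>v\<in>- C. x $ v)
      + (1 - \<alpha> / 2) * (\<Sum>i\<in>C. (x $ i - 1 / real (card C))\<^sup>2)"
    using \<alpha> \<epsilon> by (elim disjE) (intro add_pos_nonneg add_nonneg_pos mult_pos_pos mult_nonneg_nonneg; simp)+
  then show ?thesis
    using motzkin_straus_upper[OF F C \<alpha> x close] by linarith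
qed

text \<open>The budget is exhausted at \<open>y\<close>, so weight put on absent edges is paid for
  by at least as much weight taken from present ones. The payment costs \<beta>/2 per unit, and the
  bound on \<epsilon> keeps the gain per unit below that.\<close>

lemma added_edges_strict_local_maximum:
  fixes E :: "'n::finite set set"
  assumes y: "y \<in> D s E" "(\<Sum>a\<in>compl_edges E. y $ a) = real s"
    and C: "\<forall>a\<in>[C]\<^bsup>2\<^esup> \<inter> compl_edges E. y $ a = 1"
    and x: "x \<in> std_simplex" and x_close: "\<And>i. i \<notin> C \<Longrightarrow> x $ i \<le> \<epsilon>"
    and y': "y' \<in> D' s E" "y' \<noteq> y" and y'_close: "\<And>a. y' $ a \<le> y $ a + \<epsilon>"
    and \<beta>: "0 < \<beta>" and \<epsilon>: "((real CARD('n))\<^sup>2 + \<beta> / 2) * \<epsilon> < \<beta> / 2"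
    and \<epsilon>0: "0 < \<epsilon>"
  shows "x \<bullet> (added_matrix E (y' - y) *v x) + \<beta> / 2 * (norm y')\<^sup>2 < \<beta> / 2 * (norm y)\<^sup>2"
proof -
  let ?N = "compl_edges E"
  define ones where "ones = {a \<in> ?N. y $ a = 1}"
  define zeros where "zeros = {a \<in> ?N. y $ a = 0}"
  define removed where "removed = (\<Sum>a\<in>ones. 1 - y' $ a)"
  define added where "added = (\<Sum>a\<in>zeros. y' $ a)"
  have N: "?N = ones \<union> zeros" "ones \<inter> zeros = {}"
    using y by (auto simp: ones_def zeros_def D_def)
  have split: "sum f ?N = sum f ones + sum f zeros" for f :: "'n set \<Rightarrow> real"
    unfolding N(1) by (rule sum.union_disjoint) (use N(2) in auto)
  have y'_01: "\<And>a. a \<in> ?N \<Longrightarrow> 0 \<le> y' $ a \<and> y' $ a \<le> 1" and y'_out: "\<And>a. a \<notin> ?N \<Longrightarrow> y' $ a = 0"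
    and y'_sum: "(\<Sum>a\<in>?N. y' $ a) \<le> real s"
    using y' by (auto simp: D'_def)
  have y_out: "\<And>a. a \<notin> ?N \<Longrightarrow> y $ a = 0"
    using y by (auto simp: D_def)
  have x_nonneg: "\<And>i. 0 \<le> x $ i" and x_sum: "(\<Sum>i\<in>UNIV. x $ i) = 1"
    using x by (auto simp: std_simplex_def)
  have x_le: "x $ i \<le> 1" for i
    using member_le_sum[of i UNIV "($) x"] x_nonneg x_sum by auto
  have added_nonneg: "0 \<le> added"
    unfolding added_def by (rule sum_nonneg) (use y'_01 N in auto)
  have "added \<le> removed"
  proof -
    have "(\<Sum>a\<in>ones. y $ a) = (\<Sum>a\<in>ones. 1)" "(\<Sum>a\<in>zeros. y $ a) = 0"
      by (auto intro!: sum.cong sum.neutral simp: ones_def zeros_def)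
    then show ?thesis
      using y'_sum y(2) unfolding split removed_def added_def by (simp add: sum_subtractf)
  qed
  \<comment> \<open>If nothing is removed, nothing can be added either, and then \<open>y'\<close>
    equals \<open>y\<close>.\<close>
  have removed_pos: "0 < removed"
  proof (rule ccontr)
    assume "\<not> ?thesis"
    then have "added = 0" "removed = 0"
      using \<open>added \<le> removed\<close> added_nonneg by auto
    then have "\<forall>a\<in>ones. 1 - y' $ a = 0" "\<forall>a\<in>zeros. y' $ a = 0"
      unfolding added_def removed_def using y'_01 N(1)
      by (auto simp: sum_nonneg_eq_0_iff simp del: right_minus_eq)
    then have "\<forall>a\<in>ones. y' $ a = y $ a" "\<forall>a\<in>zeros. y' $ a = y $ a"
      by (auto simp: ones_def zeros_def)
    then have "y' $ a = y $ a" for a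
      using y_out[of a] y'_out[of a] N(1) by (cases "a \<in> ?N") auto
    then show False
      using y'(2) by (simp add: vec_eq_iff)
  qed
  \<comment> \<open>A crude bound uniform in \<open>i\<close> and \<open>j\<close> suffices. Removed
    edges contribute nonpositively; an absent edge has an endpoint outside \<open>C\<close>, where
    \<open>x\<close> is at most \<epsilon>.\<close>
  have entry: "added_matrix E (y' - y) $ i $ j * x $ i * x $ j \<le> \<epsilon> * added" for i j
  proof (cases "{i, j} \<in> zeros")
    case False
    then have "{i, j} \<in> ?N \<Longrightarrow> y $ {i, j} = 1"
      using N(1) unfolding ones_def by blast
    then have "added_matrix E (y' - y) $ i $ j \<le> 0"
      using y'_01[of "{i, j}"] by (simp add: added_matrix_def)
    then have "added_matrix E (y' - y) $ i $ j * (x $ i * x $ j) \<le> 0"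
      using x_nonneg by (simp add: mult_nonpos_nonneg)
    moreover have "0 \<le> \<epsilon> * added"
      using \<epsilon>0 added_nonneg by simp
    ultimately show ?thesis
      by (simp add: mult.assoc)
  next
    case True
    then have ij: "{i, j} \<in> ?N" "y $ {i, j} = 0"
      by (auto simp: zeros_def)
    then have outside: "\<not> (i \<in> C \<and> j \<in> C)"
      using bspec[OF C, of "{i, j}"] by (auto simp: doubleton_in_compl_edges)
    have "x $ i * x $ j \<le> \<epsilon>"
    proof (cases "i \<in> C")
      case True
      then show ?thesis
        using mult_mono[of "x $ i" 1 "x $ j" \<epsilon>] x_le[of i] x_close[of j] x_nonneg
          outside by simp
    next
      case False
      then show ?thesis
        using mult_mono[of "x $ i" \<epsilon> "x $ j" 1] x_le[of j] x_close[of i] x_nonneg \<epsilon>0 by simp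
    qed
    moreover have "y' $ {i, j} \<le> added"
      unfolding added_def using True y'_01 N by (intro member_le_sum) auto
    ultimately have "(x $ i * x $ j) * y' $ {i, j} \<le> \<epsilon> * added"
      using \<epsilon>0 y'_01[OF ij(1)] by (intro mult_mono) auto
    then show ?thesis
      using ij by (simp add: added_matrix_def mult_ac)
  qed
  have "x \<bullet> (added_matrix E (y' - y) *v x) \<le> (\<Sum>i\<in>(UNIV :: 'n set). \<Sum>j\<in>(UNIV :: 'n set). \<epsilon> * added)"
    unfolding inner_matrix_vector by (intro sum_mono entry)
  also have "\<dots> = (real CARD('n))\<^sup>2 * \<epsilon> * added"
    by (simp add: power2_eq_square)
  finally have form: "x \<bullet> (added_matrix E (y' - y) *v x) \<le> (real CARD('n))\<^sup>2 * \<epsilon> * added" .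
  have "(norm y')\<^sup>2 - (norm y)\<^sup>2 = (\<Sum>a\<in>?N. (y' $ a)\<^sup>2 - (y $ a)\<^sup>2)"
    using norm_D'[OF y'(1)] norm_D'[of y s E] y(1) D_subset_D'[of s E] by (auto simp: sum_subtractf)
  \<comment> \<open>On a present edge the square of \<open>y' $ a\<close> is at most
    \<open>y' $ a\<close> itself; on an absent one closeness gives the factor \<epsilon>.\<close>
  also have "\<dots> \<le> (\<Sum>a\<in>ones. - (1 - y' $ a)) + (\<Sum>a\<in>zeros. \<epsilon> * y' $ a)"
    unfolding split
  proof (intro add_mono sum_mono)
    fix a assume "a \<in> ones"
    then show "(y' $ a)\<^sup>2 - (y $ a)\<^sup>2 \<le> - (1 - y' $ a)"
      using y'_01[of a] mult_left_mono[of "y' $ a" 1 "y' $ a"]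
      by (simp add: ones_def power2_eq_square)
  next
    fix a assume "a \<in> zeros"
    then show "(y' $ a)\<^sup>2 - (y $ a)\<^sup>2 \<le> \<epsilon> * y' $ a"
      using y'_01[of a] y'_close[of a] by (simp add: zeros_def power2_eq_square mult_right_mono)
  qed
  also have "\<dots> = \<epsilon> * added - removed"
    unfolding added_def removed_def sum_distrib_left sum_negf by simp
  finally have "\<beta> / 2 * ((norm y')\<^sup>2 - (norm y)\<^sup>2) \<le> \<beta> / 2 * (\<epsilon> * added - removed)"
    using \<beta> by (intro mult_left_mono) auto
  with form have "x \<bullet> (added_matrix E (y' - y) *v x) + \<beta> / 2 * (norm y')\<^sup>2 - \<beta> / 2 * (norm y)\<^sup>2
      \<le> ((real CARD('n))\<^sup>2 + \<beta> / 2) * \<epsilon> * added - \<beta> / 2 * removed"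
    by (simp add: algebra_simps)
  also have "\<dots> \<le> ((real CARD('n))\<^sup>2 + \<beta> / 2) * \<epsilon> * removed - \<beta> / 2 * removed"
    using \<open>added \<le> removed\<close> \<beta> \<epsilon>0 by (intro diff_right_mono mult_left_mono) auto
  also have "\<dots> < 0"
    using mult_strict_right_mono[OF \<epsilon> removed_pos] by simp
  finally show ?thesis
    by simp
qed

section \<open>Maximizers and clique certificates\<close>

lemma clique_certificate_h:
  assumes E: "simple_graph E" and cert: "clique_certificate s E C y"
  shows "h E \<alpha> \<beta> (barycenter C, y) = 1 - (2 - \<alpha>) / (2 * real (card C)) + real s * (\<beta> / 2)"
proof -
  have y: "y \<in> D s E" and sum_y: "real s = (\<Sum>a\<in>compl_edges E. y $ a)"
    and C: "maximal_clique C (added_graph E y)"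
    using cert by (auto simp: clique_certificate_def)
  have ne: "C \<noteq> {}"
    using C by (rule maximal_clique_nonempty)
  have "(norm y)\<^sup>2 = (\<Sum>a\<in>compl_edges E. (y $ a)\<^sup>2)"
    using y D_subset_D' norm_D' by blast
  \<comment> \<open>Each component is 0 or 1 and so equals its square.\<close>
  also have "\<dots> = real s"
    unfolding sum_y by (rule sum.cong) (use y in \<open>auto simp: D_def\<close>)
  finally have "(norm y)\<^sup>2 = real s" .
  moreover have "motzkin_straus (added_graph E y) \<alpha> (barycenter C) = 1 - (1 - \<alpha> / 2) / real (card C)"
    using motzkin_straus_barycenter[OF simple_graph_added_graph[OF E] _ ne] C
    by (simp add: maximal_clique_def)
  moreover have "(1 - \<alpha> / 2) / real (card C) = (2 - \<alpha>) / (2 * real (card C))"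
    by (simp add: field_simps)
  ultimately show ?thesis
    by (simp add: h_eq_motzkin_straus[OF y])
qed

text \<open>Integrality of \<open>y\<close> comes first: only then is \<open>h\<close> in the
  variable \<open>x\<close> a Motzkin-Straus form of an actual graph, up to a constant.\<close>

lemma local_maximizer_on_imp_clique_certificate:
  fixes E :: "'n::finite set set"
  assumes E: "simple_graph E" and s: "s \<le> card (compl_edges E)"
    and \<alpha>: "0 < \<alpha>" "\<alpha> < 2" and \<beta>: "0 < \<beta>"
    and max: "local_maximizer_on (P s E) (h E \<alpha> \<beta>) (x, y)"
  shows "\<exists>C. x = barycenter C \<and> clique_certificate s E C y"
proof -
  let ?F = "added_graph E y"
  have x: "x \<in> std_simplex"
    using max by (auto simp: local_maximizer_on_def P_def)
  have "y \<in> D s E \<and> (\<Sum>a\<in>compl_edges E. y $ a) = real s"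
    using x max unfolding P_def
    by (intro local_maximizer_on_D'[OF s \<beta>, of x] local_maximizer_on_snd)
      (auto simp: std_simplex_def)
  then have y: "y \<in> D s E" and sum_y: "(\<Sum>a\<in>compl_edges E. y $ a) = real s"
    by auto
  have "h E \<alpha> \<beta> (x', y) = motzkin_straus ?F \<alpha> x' + \<beta> / 2 * (norm y)\<^sup>2" for x'
    by (simp add: h_eq_motzkin_straus[OF y])
  then have "local_maximizer_on std_simplex (motzkin_straus ?F \<alpha>) x"
    using local_maximizer_on_fst[OF max[unfolded P_def]] by (simp add: local_maximizer_on_def)
  then obtain C where C: "maximal_clique C ?F" and x_eq: "x = barycenter C"
    using local_maximizer_on_motzkin_straus[OF simple_graph_added_graph[OF E] \<alpha>] by blast
  have ones: "\<forall>a\<in>[C]\<^bsup>2\<^esup> \<inter> compl_edges E. y $ a = 1"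
  proof
    fix a assume a: "a \<in> [C]\<^bsup>2\<^esup> \<inter> compl_edges E"
    then obtain i j where ij: "i \<noteq> j" "a = {i, j}"
      by (elim IntE compl_edges_obtain)
    then have "i \<in> C" "j \<in> C"
      using a by auto
    then have "a \<in> ?F"
      using ij C unfolding maximal_clique_def clique_def by blast
    then show "y $ a = 1"
      using a by (auto simp: added_graph_def compl_edges_def)
  qed
  have "[C]\<^bsup>2\<^esup> - E = [C]\<^bsup>2\<^esup> \<inter> compl_edges E"
    by (auto simp: compl_edges_def nsets_def)
  \<comment> \<open>Every missing pair inside \<open>C\<close> has weight 1, so counting these pairs
    is summing part of the budget.\<close>
  then have "real (card ([C]\<^bsup>2\<^esup> - E)) = (\<Sum>a\<in>[C]\<^bsup>2\<^esup> \<inter> compl_edges E. y $ a)"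
    using ones by simp
  also have "\<dots> \<le> real s"
    unfolding sum_y[symmetric] by (rule sum_mono2) (use y in \<open>auto simp: D_def\<close>)
  finally have "defective_clique s C E"
    by (simp add: defective_clique_def)
  then show ?thesis
    using x_eq y sum_y C ones by (auto simp: clique_certificate_def)
qed

lemma clique_certificate_imp_strict_local_maximizer_on:
  fixes E :: "'n::finite set set"
  assumes E: "simple_graph E" and \<alpha>: "0 < \<alpha>" "\<alpha> < 2" and \<beta>: "0 < \<beta>"
    and cert: "clique_certificate s E C y" and P: "(barycenter C, y) \<in> P s E"
  shows "strict_local_maximizer_on (P s E) (h E \<alpha> \<beta>) (barycenter C, y)"
proof -
  let ?F = "added_graph E y"
  let ?p = "(barycenter C, y)"
  have y: "y \<in> D s E" "(\<Sum>a\<in>compl_edges E. y $ a) = real s"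
    and C: "maximal_clique C ?F" and ones: "\<forall>a\<in>[C]\<^bsup>2\<^esup> \<inter> compl_edges E. y $ a = 1"
    using cert by (auto simp: clique_certificate_def)
  have F: "simple_graph ?F"
    using E by (rule simple_graph_added_graph)
  have c: "0 < card C"
    using maximal_clique_nonempty[OF C] by (simp add: card_gt_0_iff)
  define N where "N = (real CARD('n))\<^sup>2 + \<beta> / 2"
  have N: "0 < N"
    using \<beta> by (simp add: N_def add_nonneg_pos)
  \<comment> \<open>The first bound is half the threshold for the vertex weights; the second makes
    \<open>N * \<epsilon>\<close> at most \<beta>/4, half the threshold for the edge
    weights.\<close>
  define \<epsilon> where "\<epsilon> = min (\<alpha> / (4 * real (card C))) (\<beta> / (4 * N))"
  have \<epsilon>0: "0 < \<epsilon>"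
    using \<alpha> \<beta> c N by (simp add: \<epsilon>_def)
  have "\<epsilon> \<le> \<alpha> / (4 * real (card C))"
    by (simp add: \<epsilon>_def)
  also have "\<dots> < \<alpha> / (2 * real (card C))"
    using \<alpha> c by (simp add: field_simps)
  finally have \<epsilon>1: "\<epsilon> < \<alpha> / (2 * real (card C))" .
  have "N * \<epsilon> \<le> N * (\<beta> / (4 * N))"
    using N by (intro mult_left_mono) (auto simp: \<epsilon>_def)
  also have "\<dots> < \<beta> / 2"
    using N \<beta> by simp
  finally have \<epsilon>2: "N * \<epsilon> < \<beta> / 2" .
  have "h E \<alpha> \<beta> q < h E \<alpha> \<beta> ?p" if q: "q \<in> P s E" "q \<noteq> ?p" "dist q ?p < \<epsilon>" for q
  proof -
    obtain x' y' where q_eq: "q = (x', y')"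
      by (cases q)
    have x': "x' \<in> std_simplex" and y': "y' \<in> D' s E"
      using q(1) by (auto simp: q_eq P_def)
    have x_close: "\<bar>x' $ i - barycenter C $ i\<bar> < \<epsilon>" for i
      using dist_vec_nth_le[of x' i "barycenter C"] dist_fst_le[of q ?p] q(3)
      by (simp add: q_eq dist_real_def)
    have y_close: "\<bar>y' $ a - y $ a\<bar> < \<epsilon>" for a
      using dist_vec_nth_le[of y' a y] dist_snd_le[of q ?p] q(3)
      by (simp add: q_eq dist_real_def)
    have low: "barycenter C $ i - \<epsilon> \<le> x' $ i" for i
      using x_close[of i] by simp
    have high: "x' $ i \<le> \<epsilon>" if "i \<notin> C" for i
      using x_close[of i] that by (simp add: barycenter_nth)
    have y_high: "y' $ a \<le> y $ a + \<epsilon>" for a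
      using y_close[of a] by simp
    have x_lt: "motzkin_straus ?F \<alpha> x' < motzkin_straus ?F \<alpha> (barycenter C)" if "x' \<noteq> barycenter C"
      using motzkin_straus_strict_local_maximum[OF F C \<alpha>(2) x' low \<epsilon>1 that] .
    have y_lt: "x' \<bullet> (added_matrix E (y' - y) *v x') + \<beta> / 2 * (norm y')\<^sup>2 < \<beta> / 2 * (norm y)\<^sup>2"
      if "y' \<noteq> y"
      using added_edges_strict_local_maximum[OF y ones x' high y' that y_high \<beta> \<epsilon>2[unfolded N_def] \<epsilon>0] .
    \<comment> \<open>The two comparisons add up, and at least one of them is strict because
      \<open>q\<close> differs from the certified point.\<close>
    show ?thesis
      using x_lt y_lt q(2) unfolding q_eq h_eq_motzkin_straus[OF y(1)]
      by (cases "x' = barycenter C"; cases "y' = y") auto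
  qed
  then show ?thesis
    unfolding strict_local_maximizer_on_def eventually_at using P \<epsilon>0 by blast
qed

theorem proposition3p1:
  fixes E :: "'n::finite set set" and s :: nat and \<alpha> \<beta> :: real
    and p :: "(real ^ 'n) \<times> (real ^ 'n set)"
  assumes "simple_graph E"
    and "s \<le> card (compl_edges E)"
    and "0 < \<alpha>" and "\<alpha> < 2" and "0 < \<beta>"
    and "p \<in> P s E"
  shows "(local_maximizer_on (P s E) (h E \<alpha> \<beta>) p \<longleftrightarrow> p \<in> M s \<alpha> \<beta> E)
    \<and> (p \<in> M s \<alpha> \<beta> E \<longleftrightarrow> (\<exists>C y. p = (barycenter C, y) \<and> clique_certificate s E C y))
    \<and> (\<forall>C y. p = (barycenter C, y) \<and> clique_certificate s E C y
         \<longrightarrow> h E \<alpha> \<beta> p = 1 - (2 - \<alpha>) / (2 * real (card C)) + real s * (\<beta> / 2))"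
proof -
  \<comment> \<open>The implications run in a cycle: strict maximizer, maximizer, certificate,
    strict maximizer.\<close>
  have "local_maximizer_on (P s E) (h E \<alpha> \<beta>) p" if "p \<in> M s \<alpha> \<beta> E"
    using that by (simp add: M_def strict_local_maximizer_on_imp_local_maximizer_on)
  moreover have "\<exists>C y. p = (barycenter C, y) \<and> clique_certificate s E C y"
    if "local_maximizer_on (P s E) (h E \<alpha> \<beta>) p"
    using local_maximizer_on_imp_clique_certificate[OF assms(1-5), of "fst p" "snd p"] that
    by (metis prod.collapse)
  moreover have "p \<in> M s \<alpha> \<beta> E" if "\<exists>C y. p = (barycenter C, y) \<and> clique_certificate s E C y"
    using that clique_certificate_imp_strict_local_maximizer_on[OF assms(1,3-5)] assms(6)
    by (auto simp: M_def)
  ultimately show ?thesis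
    using clique_certificate_h[OF assms(1)] by blast
qed

end
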